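(* Let $m$ and $n$ be relatively prime integers greater than $1$. Let $S_{m,n}=(S,X,\rho,\tau)$ be the invertible automaton with $S=\{s_0,\dots,s_{m-1}\}$, $X=\{x_0,\dots,x_{n-1}\}$ and $$\rho(s_i,x_j)=x_{(mj+i)\boxdot n},\qquad \tau(s_i,x_j)=s_{(mj+i)\div n}.$$ Then the group $G(S_{m,n})$ of this automaton is isomorphic to the solvable Baumslag–Solitar group $$BS(1,m)=\langle\, a,t \mid tat^{-1}=a^m \,\rangle .$$
   Context: For an integer $a$ and a positive integer $b$, $a\boxdot b\in\{0,\dots,b-1\}$ and $a\div b$ denote the remainder and the quotient of the division of $a$ by $b$, so $a=b(a\div b)+(a\boxdot b)$. An automaton is a quadruple $A=(Q,X,\rho,\tau)$ with $Q$ a finite set (states), $X$ a finite set (alphabet), and functions $\rho:Q\times X\to X$ (rewriting) and $\tau:Q\times X\to Q$ (transition). It is invertible if for every $q\in Q$ the map $\rho_q:X\to X$, $x\mapsto\rho(q,x)$, is a permutation. Each state $q$ of an invertible automaton defines an automorphism, also denoted $q$, of the rooted tree $X^*$ of finite words over $X$ (equivalently a transformation of the infinite words over $X$), recursively by $q(\emptyset)=\emptyset$ and $q(xw)=\rho(q,x)\,q_x(w)$, where $q_x=\tau(q,x)$, for $x\in X$ and $w$ a word. The group of the automaton, $G(A)$, is the subgroup of $\mathrm{Aut}(X^* )$ generated by the automorphisms defined by all states $q\in Q$. *)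

theory Defs
  imports "HOL-Algebra.Bij" "HOL-Algebra.Generated_Groups" "HOL-Number_Theory.Cong"
begin

section \<open>Automata and their groups\<close>

record ('q, 'x) automaton =
  states :: "'q set"
  alphabet :: "'x set"
  rewriting :: "'q \<Rightarrow> 'x \<Rightarrow> 'x"
  transition :: "'q \<Rightarrow> 'x \<Rightarrow> 'q"

locale wf_automaton =
  fixes A :: "('q, 'x) automaton"
  assumes finite_states: "finite (states A)"
    and finite_alphabet: "finite (alphabet A)"
    and rewriting_closed: "\<lbrakk>q \<in> states A; x \<in> alphabet A\<rbrakk> \<Longrightarrow> rewriting A q x \<in> alphabet A"
    and transition_closed: "\<lbrakk>q \<in> states A; x \<in> alphabet A\<rbrakk> \<Longrightarrow> transition A q x \<in> states A"

locale invertible_automaton = wf_automaton +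
  assumes rewriting_bij: "q \<in> states A \<Longrightarrow> bij_betw (rewriting A q) (alphabet A) (alphabet A)"

definition tree_edge :: "'x list \<Rightarrow> 'x list \<Rightarrow> bool"
  where "tree_edge u v \<longleftrightarrow> (\<exists>x. v = u @ [x])"

text \<open>The vertices of the rooted tree are the words over \<open>X\<close>. Its automorphisms are taken to be
  extensional functions on \<open>lists X\<close>, as in \<^const>\<open>BijGroup\<close>; the product \<open>f \<otimes> g\<close> is \<open>f\<close> after \<open>g\<close>.\<close>

definition tree_auts :: "'x set \<Rightarrow> ('x list \<Rightarrow> 'x list) set"
  where "tree_auts X = {f \<in> Bij (lists X). f [] = [] \<and>
    (\<forall>u\<in>lists X. \<forall>v\<in>lists X. tree_edge (f u) (f v) \<longleftrightarrow> tree_edge u v)}"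

definition TreeAut :: "'x set \<Rightarrow> ('x list \<Rightarrow> 'x list) monoid"
  where "TreeAut X = (BijGroup (lists X))\<lparr>carrier := tree_auts X\<rparr>"

fun act :: "('q, 'x) automaton \<Rightarrow> 'q \<Rightarrow> 'x list \<Rightarrow> 'x list" where
  "act A q [] = []"
| "act A q (x # w) = rewriting A q x # act A (transition A q x) w"

definition state_aut :: "('q, 'x) automaton \<Rightarrow> 'q \<Rightarrow> 'x list \<Rightarrow> 'x list"
  where "state_aut A q = restrict (act A q) (lists (alphabet A))"

definition automaton_group :: "('q, 'x) automaton \<Rightarrow> ('x list \<Rightarrow> 'x list) monoid"
  where "automaton_group A = (TreeAut (alphabet A))
    \<lparr>carrier := generate (TreeAut (alphabet A)) (state_aut A ` states A)\<rparr>"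

lemma tree_auts_subgroup: "subgroup (tree_auts X) (BijGroup (lists X))"
proof (rule group.subgroupI[OF group_BijGroup])
  show "tree_auts X \<subseteq> carrier (BijGroup (lists X))"
    by (auto simp: tree_auts_def BijGroup_def)
  have "(\<lambda>x\<in>lists X. x) \<in> tree_auts X"
    by (auto simp: tree_auts_def id_Bij)
  then show "tree_auts X \<noteq> {}" by blast
next
  fix f assume f: "f \<in> tree_auts X"
  then have fB: "f \<in> Bij (lists X)" and f0: "f [] = []"
    and fe: "\<And>u v. \<lbrakk>u \<in> lists X; v \<in> lists X\<rbrakk> \<Longrightarrow> tree_edge (f u) (f v) \<longleftrightarrow> tree_edge u v"
    by (auto simp: tree_auts_def)
  have bij: "bij_betw f (lists X) (lists X)" using fB by (simp add: Bij_def)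
  let ?g = "restrict (inv_into (lists X) f) (lists X)"
  have gl: "?g u \<in> lists X" "f (?g u) = u" if "u \<in> lists X" for u
    using that bij Bij_inv_into_mem[OF fB that]
    by (auto simp: bij_betw_inv_into_right)
  have "?g [] = []"
    using bij_betw_inv_into_left[OF bij, of "[]"] f0 by simp
  moreover have "tree_edge (?g u) (?g v) \<longleftrightarrow> tree_edge u v"
    if "u \<in> lists X" "v \<in> lists X" for u v
    using fe[of "?g u" "?g v"] gl[OF that(1)] gl[OF that(2)] by simp
  ultimately show "inv\<^bsub>BijGroup (lists X)\<^esub> f \<in> tree_auts X"
    using restrict_inv_into_Bij[OF fB] by (auto simp: inv_BijGroup[OF fB] tree_auts_def)
next
  fix f g assume f: "f \<in> tree_auts X" and g: "g \<in> tree_auts X"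
  then have B: "f \<in> Bij (lists X)" "g \<in> Bij (lists X)" by (auto simp: tree_auts_def)
  have gm: "g u \<in> lists X" if "u \<in> lists X" for u
    using Bij_imp_funcset[OF B(2)] that by blast
  have "compose (lists X) f g \<in> tree_auts X"
    using f g gm compose_Bij[OF B] by (simp add: tree_auts_def compose_def)
  then show "f \<otimes>\<^bsub>BijGroup (lists X)\<^esub> g \<in> tree_auts X"
    using B by (simp add: BijGroup_def)
qed

lemma group_TreeAut: "group (TreeAut X)"
  unfolding TreeAut_def
  by (rule subgroup.subgroup_is_group[OF tree_auts_subgroup group_BijGroup])

context wf_automaton
begin

lemma act_append:
  assumes "q \<in> states A" "u \<in> lists (alphabet A)"
  shows "\<exists>p\<in>states A. \<forall>v. act A q (u @ v) = act A q u @ act A p v"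
  using assms
proof (induction u arbitrary: q)
  case Nil
  then show ?case by auto
next
  case (Cons x u)
  then show ?case using transition_closed[of q x] by fastforce
qed

lemma act_closed:
  assumes "q \<in> states A" "u \<in> lists (alphabet A)"
  shows "act A q u \<in> lists (alphabet A)"
  using assms by (induction u arbitrary: q) (auto simp: rewriting_closed transition_closed)

end

lemma length_act [simp]: "length (act A q u) = length u"
  by (induction u arbitrary: q) auto

context invertible_automaton
begin

lemma act_inj:
  assumes "q \<in> states A" "u \<in> lists (alphabet A)" "v \<in> lists (alphabet A)"
    "act A q u = act A q v"
  shows "u = v"
  using assms
proof (induction u arbitrary: q v)
  case Nil
  then show ?case by (cases v) auto
next
  case (Cons x u)
  then obtain y v' where v: "v = y # v'" by (cases v) auto
  have "x = y"
    using Cons.prems v rewriting_bij[of q] by (auto simp: bij_betw_def dest: inj_onD)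
  moreover have "u = v'"
    by (rule Cons.IH[of "transition A q x"])
      (use Cons.prems v \<open>x = y\<close> transition_closed in auto)
  ultimately show ?case using v by simp
qed

lemma act_surj:
  assumes "q \<in> states A" "w \<in> lists (alphabet A)"
  shows "\<exists>u\<in>lists (alphabet A). act A q u = w"
  using assms
proof (induction w arbitrary: q)
  case Nil
  then show ?case by (auto intro!: bexI[of _ "[]"])
next
  case (Cons y w)
  obtain x where x: "x \<in> alphabet A" "rewriting A q x = y"
    using Cons.prems bij_betw_imp_surj_on[OF rewriting_bij[of q]] by force
  obtain u where "u \<in> lists (alphabet A)" "act A (transition A q x) u = w"
    using Cons.IH[of "transition A q x"] Cons.prems x transition_closed[of q x] by auto
  then show ?case using x by (auto intro!: bexI[of _ "x # u"])
qed

lemma act_edge: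
  assumes "q \<in> states A" "u \<in> lists (alphabet A)" "v \<in> lists (alphabet A)"
  shows "tree_edge (act A q u) (act A q v) \<longleftrightarrow> tree_edge u v"
proof
  assume "tree_edge u v"
  then obtain x where v: "v = u @ [x]" by (auto simp: tree_edge_def)
  with act_append[OF assms(1,2)] show "tree_edge (act A q u) (act A q v)"
    by (auto simp: tree_edge_def)
next
  assume "tree_edge (act A q u) (act A q v)"
  then obtain y where y: "act A q v = act A q u @ [y]" by (auto simp: tree_edge_def)
  then have "length (act A q v) = Suc (length (act A q u))" by simp
  then have "v \<noteq> []" by auto
  then obtain v' x where v: "v = v' @ [x]" by (metis rev_exhaust)
  have v': "v' \<in> lists (alphabet A)" using assms(3) v by auto
  obtain p where "act A q v = act A q v' @ act A p [x]"
    using act_append[OF assms(1) v'] v by auto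
  with y have "act A q v' = act A q u" by auto
  with act_inj[OF assms(1) v' assms(2)] v show "tree_edge u v"
    by (auto simp: tree_edge_def)
qed

lemma state_aut_tree_auts:
  assumes q: "q \<in> states A"
  shows "state_aut A q \<in> tree_auts (alphabet A)"
proof -
  have "bij_betw (act A q) (lists (alphabet A)) (lists (alphabet A))"
  proof (rule bij_betw_imageI)
    show "inj_on (act A q) (lists (alphabet A))"
      using act_inj[OF q] by (rule inj_onI)
    show "act A q ` lists (alphabet A) = lists (alphabet A)"
      using act_surj[OF q] act_closed[OF q] by blast
  qed
  then have "state_aut A q \<in> Bij (lists (alphabet A))"
    by (simp add: Bij_def state_aut_def)
  then show ?thesis
    using act_edge[OF q] by (simp add: tree_auts_def state_aut_def)
qed

lemma group_automaton_group: "group (automaton_group A)"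
proof -
  have "state_aut A ` states A \<subseteq> carrier (TreeAut (alphabet A))"
    using state_aut_tree_auts by (auto simp: TreeAut_def)
  then show ?thesis
    unfolding automaton_group_def
    by (intro subgroup.subgroup_is_group group.generate_is_subgroup group_TreeAut)
qed

end


section \<open>The automaton \<open>S\<^bsub>m,n\<^esub>\<close>\<close>

text \<open>The state \<open>s\<^sub>i\<close> is represented by its index \<open>i\<close>, and the letter \<open>x\<^sub>j\<close> by \<open>j\<close>.\<close>

definition S_automaton :: "nat \<Rightarrow> nat \<Rightarrow> (nat, nat) automaton"
  where "S_automaton m n =
    \<lparr>states = {..<m}, alphabet = {..<n},
     rewriting = (\<lambda>i j. (m * j + i) mod n),
     transition = (\<lambda>i j. (m * j + i) div n)\<rparr>"

lemma S_automaton_invertible: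
  assumes "n > 0" "coprime m n"
  shows "invertible_automaton (S_automaton m n)"
proof
  fix i j assume "i \<in> states (S_automaton m n)" "j \<in> alphabet (S_automaton m n)"
  then have "i < m" "Suc j \<le> n" by (auto simp: S_automaton_def)
  then have "m * j + i < m * Suc j" "m * Suc j \<le> m * n" by (simp, intro mult_le_mono2)
  then have "m * j + i < m * n" by (rule less_le_trans)
  then show "transition (S_automaton m n) i j \<in> states (S_automaton m n)"
    using assms by (simp add: S_automaton_def less_mult_imp_div_less)
next
  fix i
  have "inj_on (\<lambda>j. (m * j + i) mod n) {..<n}"
  proof (rule inj_onI)
    fix j k assume jk: "j \<in> {..<n}" "k \<in> {..<n}" "(m * j + i) mod n = (m * k + i) mod n"
    then have "[m * j = m * k] (mod n)"
      using cong_add_rcancel_nat cong_def by blast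
    then have "[j = k] (mod n)" using assms cong_mult_lcancel_nat by blast
    then show "j = k" using jk cong_less_modulus_unique_nat by auto
  qed
  moreover have "(\<lambda>j. (m * j + i) mod n) ` {..<n} \<subseteq> {..<n}" using assms by auto
  ultimately show "bij_betw (rewriting (S_automaton m n) i)
      (alphabet (S_automaton m n)) (alphabet (S_automaton m n))"
    by (simp add: S_automaton_def bij_betw_def endo_inj_surj)
qed (use assms in \<open>auto simp: S_automaton_def\<close>)


section \<open>Group presentations\<close>

text \<open>The free group on a type \<open>'g\<close> of generators: words in the letters \<open>(g, True)\<close>, standing for
  the generator \<open>g\<close>, and \<open>(g, False)\<close>, standing for its inverse, modulo insertion and deletion
  of pairs of mutually inverse letters.\<close>

inductive cancels :: "('g \<times> bool) list \<Rightarrow> ('g \<times> bool) list \<Rightarrow> bool"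
  where "cancels (u @ [(g, b), (g, \<not> b)] @ v) (u @ v)"

definition free_rel :: "(('g \<times> bool) list \<times> ('g \<times> bool) list) set"
  where "free_rel = {(u, v). equivclp cancels u v}"

definition free_group :: "('g \<times> bool) list set monoid"
  where "free_group =
    \<lparr>carrier = UNIV // free_rel,
     monoid.mult = (\<lambda>U V. \<Union>u\<in>U. \<Union>v\<in>V. free_rel `` {u @ v}),
     one = free_rel `` {[]}\<rparr>"

definition free_gen :: "'g \<Rightarrow> ('g \<times> bool) list set"
  where "free_gen g = free_rel `` {[(g, True)]}"

definition normal_closure :: "('a, 'b) monoid_scheme \<Rightarrow> 'a set \<Rightarrow> 'a set"
  where "normal_closure G R = \<Inter>{N. N \<lhd> G \<and> R \<subseteq> N}"

text \<open>A pair \<open>(u, v)\<close> in \<open>R\<close> stands for the defining relation \<open>u = v\<close>.\<close>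

definition presented_group ::
    "(('g \<times> bool) list set \<times> ('g \<times> bool) list set) set \<Rightarrow> ('g \<times> bool) list set set monoid"
  where "presented_group R =
    free_group Mod normal_closure free_group {u \<otimes>\<^bsub>free_group\<^esub> inv\<^bsub>free_group\<^esub> v | u v. (u, v) \<in> R}"

datatype bs_gen = Gen_a | Gen_t

definition BS1 :: "nat \<Rightarrow> (bs_gen \<times> bool) list set set monoid"
  where "BS1 m = (let F = free_group; a = free_gen Gen_a; t = free_gen Gen_t
    in presented_group {(t \<otimes>\<^bsub>F\<^esub> a \<otimes>\<^bsub>F\<^esub> inv\<^bsub>F\<^esub> t, a [^]\<^bsub>F\<^esub> m)})"

lemma equiv_free_rel: "equiv UNIV free_rel"
  by (simp add: equivp_equiv free_rel_def)

lemma cancels_append: "cancels u v \<Longrightarrow> cancels (x @ u @ y) (x @ v @ y)"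
proof (induction rule: cancels.induct)
  case (1 u g b v)
  show ?case using cancels.intros[of "x @ u" g b "v @ y"] by simp
qed

lemma free_rel_append1: "(u, v) \<in> free_rel \<Longrightarrow> (x @ u @ y, x @ v @ y) \<in> free_rel"
  unfolding free_rel_def mem_Collect_eq prod.case
proof (induction rule: equivclp_induct)
  case base
  show ?case by simp
next
  case (step v w)
  then show ?case by (meson cancels_append equivclp_into_equivclp)
qed

lemma free_rel_append:
  assumes "(u, u') \<in> free_rel" "(v, v') \<in> free_rel"
  shows "(u @ v, u' @ v') \<in> free_rel"
proof -
  have "(u @ v, u' @ v) \<in> free_rel" using free_rel_append1[OF assms(1), of "[]" v] by simp
  moreover have "(u' @ v, u' @ v') \<in> free_rel" using free_rel_append1[OF assms(2), of u' "[]"] by simp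
  ultimately show ?thesis using equiv_free_rel by (meson equivE transD)
qed

lemma free_rel_inverse: "(rev (map (\<lambda>(g, b). (g, \<not> b)) u) @ u, []) \<in> free_rel"
proof (induction u)
  case Nil
  show ?case by (simp add: free_rel_def)
next
  case (Cons x u)
  obtain g b where x: "x = (g, b)" by (cases x)
  have "cancels (rev (map (\<lambda>(g, b). (g, \<not> b)) u) @ [(g, \<not> b), (g, \<not> \<not> b)] @ u)
      (rev (map (\<lambda>(g, b). (g, \<not> b)) u) @ u)"
    by (rule cancels.intros)
  then have "(rev (map (\<lambda>(g, b). (g, \<not> b)) (x # u)) @ x # u, rev (map (\<lambda>(g, b). (g, \<not> b)) u) @ u)
      \<in> free_rel"
    by (auto simp: x free_rel_def)
  then show ?case using Cons equiv_free_rel by (meson equivE transD)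
qed

lemma free_group_mult:
  "free_rel `` {u} \<otimes>\<^bsub>free_group\<^esub> free_rel `` {v} = free_rel `` {u @ v}"
proof -
  have "congruent2 free_rel free_rel (\<lambda>u v. free_rel `` {u @ v})"
    by (intro congruent2I' equiv_class_eq[OF equiv_free_rel] free_rel_append)
  then show ?thesis
    using UN_equiv_class2[OF equiv_free_rel equiv_free_rel, of _ u v] by (simp add: free_group_def)
qed

lemma free_group_carrierE:
  assumes "x \<in> carrier free_group"
  obtains u where "x = free_rel `` {u}"
  using assms by (auto simp: free_group_def elim: quotientE)

lemma free_group_class_carrier [simp]: "free_rel `` {u} \<in> carrier free_group"
  by (simp add: free_group_def quotientI)

lemma group_free_group: "group (free_group :: ('g \<times> bool) list set monoid)"
proof (rule groupI)
  have one: "\<one>\<^bsub>free_group\<^esub> = (free_rel `` {[]} :: ('g \<times> bool) list set)" by (simp add: free_group_def)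
  then show "\<one>\<^bsub>free_group\<^esub> \<in> (carrier free_group :: ('g \<times> bool) list set set)" by simp
  fix x :: "('g \<times> bool) list set" assume "x \<in> carrier free_group"
  then obtain u where u: "x = free_rel `` {u}" by (rule free_group_carrierE)
  then show "\<one>\<^bsub>free_group\<^esub> \<otimes>\<^bsub>free_group\<^esub> x = x" by (simp add: one free_group_mult)
  have "free_rel `` {rev (map (\<lambda>(g, b). (g, \<not> b)) u)} \<otimes>\<^bsub>free_group\<^esub> x = \<one>\<^bsub>free_group\<^esub>"
    using equiv_class_eq[OF equiv_free_rel free_rel_inverse[of u]]
    by (simp add: u one free_group_mult)
  then show "\<exists>y\<in>carrier free_group. y \<otimes>\<^bsub>free_group\<^esub> x = \<one>\<^bsub>free_group\<^esub>"
    using free_group_class_carrier by blast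
qed (auto elim!: free_group_carrierE simp: free_group_mult)

lemma (in group) normal_closure_normal:
  assumes "R \<subseteq> carrier G"
  shows "normal_closure G R \<lhd> G"
proof -
  let ?C = "{N. N \<lhd> G \<and> R \<subseteq> N}"
  have G: "carrier G \<in> ?C" using normal_invI[OF subgroup_self] assms by simp
  have "subgroup (\<Inter>?C) G"
    using G by (intro subgroups_Inter) (auto simp: normal_imp_subgroup)
  then have "\<Inter>?C \<lhd> G"
    by (rule normal_invI) (auto intro: normal.inv_op_closed2)
  then show ?thesis by (simp add: normal_closure_def)
qed

lemma group_presented_group:
  assumes "R \<subseteq> carrier free_group \<times> carrier free_group"
  shows "group (presented_group R)"
proof -
  interpret group free_group by (rule group_free_group)
  show ?thesis
    unfolding presented_group_def
    using assms by (intro normal.factorgroup_is_group normal_closure_normal) auto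
qed

lemma group_BS1: "group (BS1 m)"
proof -
  interpret group free_group by (rule group_free_group)
  show ?thesis
    unfolding BS1_def Let_def free_gen_def by (intro group_presented_group) simp
qed

end

theory Submission
  imports Defs
begin

text \<open>On \<open>n\<close>-adic integers, written with the least significant digit first, the state \<open>s\<^sub>i\<close> acts
  as \<open>z \<mapsto> m z + i\<close>. Hence \<open>t = s\<^sub>0\<close> and \<open>a = s\<^sub>1 s\<^sub>0\<^sup>-\<^sup>1\<close> are multiplication by \<open>m\<close> and translation
  by \<open>1\<close>; they generate the group of the automaton because \<open>s\<^sub>i = a\<^sup>i t\<close>, and they satisfy the
  defining relation of \<open>BS(1,m)\<close>. In any group with this relation each element generated by \<open>a\<close> and
  \<open>t\<close> has the form \<open>t\<^sup>-\<^sup>p a\<^sup>k t\<^sup>q\<close>. If such an element acts trivially, then \<open>m\<^sup>p z = m\<^sup>q z + k\<close> for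
  all \<open>z\<close>, so \<open>k = 0\<close> and \<open>p = q\<close>: no further relations hold.\<close>

section \<open>Free groups\<close>

lemma free_group_one: "\<one>\<^bsub>free_group\<^esub> = free_rel `` {[]}"
  by (simp add: free_group_def)

lemma inv_free_gen: "inv\<^bsub>free_group\<^esub> (free_gen g) = free_rel `` {[(g, False)]}"
proof -
  interpret group "free_group :: ('a \<times> bool) list set monoid" by (rule group_free_group)
  have "(free_rel `` {[(g, False)]}) \<otimes>\<^bsub>free_group\<^esub> free_gen g = \<one>\<^bsub>free_group\<^esub>"
    using equiv_class_eq[OF equiv_free_rel free_rel_inverse[of "[(g, True)]"]]
    by (simp add: free_gen_def free_group_mult free_group_one)
  then show ?thesis
    by (rule inv_equality) (simp_all add: free_gen_def)
qed

lemma free_gen_carrier [simp]: "free_gen g \<in> carrier free_group"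
  by (simp add: free_gen_def)

text \<open>A word is a product of its letters, and the class of a letter is a generator or the
  inverse of one. Homomorphic images of the free group can therefore be computed from the images of
  the generators alone.\<close>

lemma generate_free_group: "generate free_group (range free_gen) = carrier free_group"
proof
  interpret group "free_group :: ('a \<times> bool) list set monoid" by (rule group_free_group)
  show "generate free_group (range free_gen) \<subseteq> (carrier free_group :: ('a \<times> bool) list set set)"
    by (rule generate_incl) auto
  have "free_rel `` {u} \<in> generate free_group (range free_gen)" for u :: "('a \<times> bool) list"
  proof (induction u)
    case Nil
    show ?case using generate.one by (metis free_group_one)
  next
    case (Cons x u)
    obtain g b where x: "x = (g, b)" by (cases x)
    have "free_rel `` {[x]} \<in> generate free_group (range free_gen)"
      using generate.incl[of "free_gen g" "range free_gen" free_group]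
        generate.inv[of "free_gen g" "range free_gen" free_group]
      by (cases b) (auto simp: x inv_free_gen, simp add: free_gen_def)
    from generate.eng[OF this Cons] show ?case by (simp add: free_group_mult)
  qed
  then show "carrier free_group \<subseteq> generate free_group (range (free_gen :: 'a \<Rightarrow> _))"
    by (auto elim!: free_group_carrierE)
qed

section \<open>Evaluation of words and the universal property of the free group\<close>

definition word_eval :: "('a, 'b) monoid_scheme \<Rightarrow> ('g \<Rightarrow> 'a) \<Rightarrow> ('g \<times> bool) list \<Rightarrow> 'a"
  where "word_eval G f u =
    foldr (\<lambda>(g, b) x. (if b then f g else inv\<^bsub>G\<^esub> f g) \<otimes>\<^bsub>G\<^esub> x) u \<one>\<^bsub>G\<^esub>"

context group
begin

lemma word_eval_closed [simp]:
  assumes "range f \<subseteq> carrier G"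
  shows "word_eval G f u \<in> carrier G"
proof -
  have "f g \<in> carrier G" for g using assms by auto
  then show ?thesis by (induction u) (auto simp: word_eval_def)
qed

lemma word_eval_append:
  assumes "range f \<subseteq> carrier G"
  shows "word_eval G f (u @ v) = word_eval G f u \<otimes> word_eval G f v"
proof (induction u)
  case Nil
  show ?case using word_eval_closed[OF assms, of v] by (simp add: word_eval_def)
next
  case (Cons x u)
  obtain g b where x: "x = (g, b)" by (cases x)
  have "f g \<in> carrier G" using assms by auto
  with Cons show ?case
    using word_eval_closed[OF assms, of u] word_eval_closed[OF assms, of v]
    by (simp add: x word_eval_def m_assoc)
qed

text \<open>A pair of mutually inverse letters evaluates to the identity, so \<open>cancels\<close>
  preserves the value, and \<open>free_rel\<close> is the equivalence generated by
  \<open>cancels\<close>.\<close>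

lemma word_eval_free_rel:
  assumes f: "range f \<subseteq> carrier G" and "(u, v) \<in> free_rel"
  shows "word_eval G f u = word_eval G f v"
proof -
  have canc: "word_eval G f u = word_eval G f v" if "cancels u v" for u v
    using that
  proof cases
    case (1 u' g b v')
    have g: "f g \<in> carrier G" using f by auto
    then have "word_eval G f ([(g, b), (g, \<not> b)]) = \<one>"
      by (simp add: word_eval_def)
    then have "word_eval G f ([(g, b), (g, \<not> b)] @ v') = word_eval G f v'"
      using f by (simp only: word_eval_append) simp
    then show ?thesis
      unfolding 1 by (simp only: word_eval_append[OF f])
  qed
  have "equivclp cancels u v" using assms by (simp add: free_rel_def)
  then show ?thesis
    by (induction rule: equivclp_induct) (auto dest: canc)
qed

lemma free_group_lift:
  assumes f: "range f \<subseteq> carrier G"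
  obtains h where "h \<in> hom free_group G" "\<And>g. h (free_gen g) = f g"
proof
  \<comment> \<open>The value is constant on each class, so the image of a class is a singleton and
    \<open>the_elem\<close> extracts that value without choosing a representative.\<close>
  let ?h = "\<lambda>U. the_elem (word_eval G f ` U)"
  have h: "?h (free_rel `` {u}) = word_eval G f u" for u
  proof -
    have "u \<in> free_rel `` {u}" by (simp add: free_rel_def)
    moreover have "word_eval G f v \<in> {word_eval G f u}" if "v \<in> free_rel `` {u}" for v
      using word_eval_free_rel[OF f, of u v] that by simp
    ultimately have "word_eval G f ` (free_rel `` {u}) = {word_eval G f u}"
      by blast
    then show ?thesis by simp
  qed
  show "?h \<in> hom free_group G"
    using f by (auto intro!: homI elim!: free_group_carrierE
        simp: free_group_mult h word_eval_append)
  have "f g \<in> carrier G" for g using f by auto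
  then have "word_eval G f [(g, True)] = f g" for g by (simp add: word_eval_def)
  then show "?h (free_gen g) = f g" for g by (simp add: free_gen_def h)
qed

end


section \<open>Baumslag--Solitar groups\<close>

context group
begin

text \<open>Conjugation by \<open>t\<close> is an endomorphism that sends \<open>a\<close> to its
  power with exponent \<open>m\<close>; applied to an integer power of \<open>a\<close>, it
  multiplies the exponent by \<open>m\<close>.\<close>

lemma BS_commute:
  fixes m :: nat and k :: int
  assumes a: "a \<in> carrier G" and t: "t \<in> carrier G" and rel: "t \<otimes> a \<otimes> inv t = a [^] m"
  shows "t \<otimes> a [^] k = a [^] (int m * k) \<otimes> t"
proof -
  have "(\<lambda>x. t \<otimes> x \<otimes> inv t) \<in> hom G G"
    using t by (intro homI) (simp_all add: m_assoc inv_solve_left)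
  from hom_int_pow[OF this a is_group is_group, of k]
  have "t \<otimes> a [^] k \<otimes> inv t = (a [^] int m) [^] k"
    by (simp add: rel int_pow_int)
  then have "t \<otimes> a [^] k \<otimes> inv t = a [^] (int m * k)"
    using a by (simp add: int_pow_pow mult.commute)
  then show ?thesis using a t by (simp add: inv_solve_right')
qed

lemma BS_commute_pow:
  fixes m q :: nat and k :: int
  assumes a: "a \<in> carrier G" and t: "t \<in> carrier G" and rel: "t \<otimes> a \<otimes> inv t = a [^] m"
  shows "t [^] q \<otimes> a [^] k = a [^] (int m ^ q * k) \<otimes> t [^] q"
proof (induction q arbitrary: k)
  case 0
  then show ?case using a by simp
next
  case (Suc q)
  have "t [^] Suc q \<otimes> a [^] k = t [^] q \<otimes> (t \<otimes> a [^] k)"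
    using a t by (simp add: m_assoc)
  also have "\<dots> = t [^] q \<otimes> a [^] (int m * k) \<otimes> t"
    using a t by (simp add: BS_commute[OF assms] m_assoc)
  also have "\<dots> = a [^] (int m ^ Suc q * k) \<otimes> t [^] Suc q"
    using a t by (simp add: Suc m_assoc mult_ac)
  finally show ?case .
qed

text \<open>The equation is the normal form t^-p a^k t^q with the inverse moved to the other side,
  so that all exponents of \<open>t\<close> are natural numbers. The form survives right
  multiplication by \<open>a\<close>, \<open>t\<close> and their inverses.\<close>

lemma BS_normal_form:
  fixes m :: nat
  assumes a: "a \<in> carrier G" and t: "t \<in> carrier G" and rel: "t \<otimes> a \<otimes> inv t = a [^] m"
    and "g \<in> generate G {a, t}"
  shows "\<exists>(p::nat) (q::nat) (k::int). t [^] p \<otimes> g = a [^] k \<otimes> t [^] q"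
proof -
  let ?P = "\<lambda>g. \<exists>(p::nat) (q::nat) (k::int). t [^] p \<otimes> g = a [^] k \<otimes> t [^] q"
  have pow_a: "?P (x \<otimes> a [^] j)" if nf: "?P x" and x: "x \<in> carrier G" for x and j :: int
  proof -
    obtain p q :: nat and k :: int where "t [^] p \<otimes> x = a [^] k \<otimes> t [^] q"
      using nf by blast
    then have "t [^] p \<otimes> (x \<otimes> a [^] j) = a [^] k \<otimes> (t [^] q \<otimes> a [^] j)"
      using a t x by (simp flip: m_assoc)
    also have "\<dots> = a [^] (k + int m ^ q * j) \<otimes> t [^] q"
      using a t by (simp add: BS_commute_pow[OF assms(1-3)] int_pow_mult m_assoc)
    finally show ?thesis by blast
  qed
  have mult_t: "?P (x \<otimes> t)" if nf: "?P x" and x: "x \<in> carrier G" for x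
  proof -
    obtain p q :: nat and k :: int where "t [^] p \<otimes> x = a [^] k \<otimes> t [^] q"
      using nf by blast
    then have "t [^] p \<otimes> (x \<otimes> t) = a [^] k \<otimes> t [^] Suc q"
      using a t x by (simp flip: m_assoc)
    then show ?thesis by blast
  qed
  have mult_inv_t: "?P (x \<otimes> inv t)" if nf: "?P x" and x: "x \<in> carrier G" for x
  proof -
    obtain p q :: nat and k :: int where pq: "t [^] p \<otimes> x = a [^] k \<otimes> t [^] q"
      using nf by blast
    \<comment> \<open>Since \<open>q\<close> may be 0, \<open>inv t\<close> cannot simply lower it.
      An extra \<open>t\<close> on the left raises both exponents of \<open>t\<close> and multiplies
      \<open>k\<close> by \<open>m\<close>; the new \<open>t\<close> on the right then absorbs
      \<open>inv t\<close>.\<close>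
    have "t [^] Suc p \<otimes> x = t \<otimes> (t [^] p \<otimes> x)"
      using t x by (simp only: nat_pow_Suc2 m_assoc nat_pow_closed)
    also have "\<dots> = t \<otimes> a [^] k \<otimes> t [^] q"
      using a t by (simp add: pq m_assoc)
    also have "\<dots> = a [^] (int m * k) \<otimes> (t \<otimes> t [^] q)"
      using a t by (simp add: BS_commute[OF assms(1-3)] m_assoc)
    also have "t \<otimes> t [^] q = t [^] q \<otimes> t"
      using t nat_pow_Suc2[of t q] by simp
    finally have "t [^] Suc p \<otimes> (x \<otimes> inv t) = a [^] (int m * k) \<otimes> t [^] q"
      using a t x by (simp flip: m_assoc) (simp add: m_assoc)
    then show ?thesis by blast
  qed
  \<comment> \<open>The rule \<open>eng\<close> multiplies two arbitrary generated elements. Proving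
    that right multiplication by \<open>g\<close> preserves the form for every \<open>x\<close>
    makes this case a composition of two such multiplications; the lemma is the case of
    \<open>x\<close> equal to the identity.\<close>
  have step: "x \<in> carrier G \<longrightarrow> ?P x \<longrightarrow> ?P (x \<otimes> g)" for x
    using assms(4)
  proof (induction arbitrary: x)
    case one
    then show ?case by auto
  next
    case (incl h)
    then show ?case using pow_a[of x 1] mult_t[of x] a by auto
  next
    case (inv h)
    then show ?case using pow_a[of x "-1"] mult_inv_t[of x] a by (auto simp: int_pow_neg)
  next
    case (eng h1 h2)
    have "h1 \<in> carrier G" "h2 \<in> carrier G"
      using eng.hyps a t generate_in_carrier[of "{a, t}"] by auto
    then have "x \<otimes> (h1 \<otimes> h2) = x \<otimes> h1 \<otimes> h2" if "x \<in> carrier G" using that by (simp add: m_assoc)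
    then show ?case
      using eng.IH(1)[of x] eng.IH(2)[of "x \<otimes> h1"] \<open>h1 \<in> carrier G\<close> by (metis m_closed)
  qed
  have "?P \<one>" using a t by (intro exI[of _ 0]) simp
  moreover have "g \<in> carrier G"
    using assms generate_in_carrier[of "{a, t}"] by auto
  ultimately show ?thesis using step[of \<one>] by simp
qed

text \<open>The free group maps onto the subgroup generated by \<open>a\<close> and
  \<open>t\<close>, so by the first isomorphism theorem it remains to see that the kernel is the
  normal closure of the relator. The hypothesis \<open>faithful\<close> says that a normal form is
  trivial only if it is visibly so.\<close>

theorem BS1_iso:
  fixes m :: nat
  assumes a: "a \<in> carrier G" and t: "t \<in> carrier G" and rel: "t \<otimes> a \<otimes> inv t = a [^] m"
    and faithful: "\<And>(p::nat) (q::nat) (k::int). t [^] p = a [^] k \<otimes> t [^] q \<Longrightarrow> k = 0 \<and> p = q"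
  shows "BS1 m \<cong> G\<lparr>carrier := generate G {a, t}\<rparr>"
proof -
  let ?F = "free_group :: (bs_gen \<times> bool) list set monoid"
  let ?a = "free_gen Gen_a" and ?t = "free_gen Gen_t"
  let ?r = "(?t \<otimes>\<^bsub>?F\<^esub> ?a \<otimes>\<^bsub>?F\<^esub> inv\<^bsub>?F\<^esub> ?t) \<otimes>\<^bsub>?F\<^esub> inv\<^bsub>?F\<^esub> (?a [^]\<^bsub>?F\<^esub> m)"
  let ?N = "normal_closure ?F {?r}"
  let ?H = "G\<lparr>carrier := generate G {a, t}\<rparr>"
  interpret F: group ?F by (rule group_free_group)
  have rF: "?r \<in> carrier ?F" by simp
  have N: "?N \<lhd> ?F" using F.normal_closure_normal rF by blast
  then interpret N: normal ?N ?F .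
  have ran_c: "range (case_bs_gen a t) \<subseteq> carrier G"
    using a t by (auto split: bs_gen.splits)
  obtain h where h: "h \<in> hom ?F G"
    and hg: "\<And>g. h (free_gen g) = (case g of Gen_a \<Rightarrow> a | Gen_t \<Rightarrow> t)"
    using free_group_lift[of "case_bs_gen a t"] ran_c by blast
  interpret h: group_hom ?F G h
    by (intro group_hom.intro group_hom_axioms.intro F.is_group is_group h)
  have ran: "range free_gen = {?a, ?t}"
  proof -
    have "UNIV = {Gen_a, Gen_t}" using bs_gen.exhaust by blast
    then show ?thesis by (metis image_empty image_insert)
  qed
  have img: "h ` carrier ?F = generate G {a, t}"
    using h.generate_img[of "range free_gen"] by (simp add: generate_free_group) (simp add: ran hg)
  have sub: "subgroup (generate G {a, t}) G" using a t by (intro generate_is_subgroup) auto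
  interpret h': group_hom ?F ?H h
  proof (intro group_hom.intro group_hom_axioms.intro)
    show "group ?H" using sub by (simp add: subgroup.subgroup_is_group)
    show "h \<in> hom ?F ?H" using h img by (auto simp: hom_def)
  qed (rule F.is_group)
  have K: "kernel ?F ?H h \<lhd> ?F" by (rule h'.normal_kernel)
  \<comment> \<open>The kernel is a normal subgroup containing the relator, and \<open>?N\<close> is
    the intersection of all of these.\<close>
  have NK: "?N \<subseteq> kernel ?F ?H h"
  proof -
    have "h ?r = \<one>"
      using a t by (simp add: h.hom_nat_pow hg rel)
    then have "{?r} \<subseteq> kernel ?F ?H h" by (simp add: kernel_def)
    then show ?thesis using K by (auto simp: normal_closure_def)
  qed
  \<comment> \<open>The relation holds in the quotient by \<open>?N\<close>, so the coset of a
    kernel element has a normal form there. Lifting it to the free group and applying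
    \<open>h\<close> makes \<open>faithful\<close> applicable.\<close>
  have "kernel ?F ?H h \<subseteq> ?N"
  proof -
    let ?B = "?F Mod ?N" and ?c = "\<lambda>x. ?N #>\<^bsub>?F\<^esub> x"
    interpret B: group ?B by (rule N.factorgroup_is_group)
    interpret c: group_hom ?F ?B ?c
      by (intro group_hom.intro group_hom_axioms.intro F.is_group B.is_group N.r_coset_hom_Mod)
    have rN: "?r \<in> ?N" by (auto simp: normal_closure_def)
    have c_one: "?c x = \<one>\<^bsub>?B\<^esub> \<longleftrightarrow> x \<in> ?N" if "x \<in> carrier ?F" for x
      using F.coset_join1[OF _ that N.subgroup_axioms] F.coset_join2[OF that N.subgroup_axioms]
        N.subset by (auto simp: FactGroup_def)
    have c_eq: "?c x = ?c y" if "x \<otimes>\<^bsub>?F\<^esub> inv\<^bsub>?F\<^esub> y \<in> ?N" "x \<in> carrier ?F" "y \<in> carrier ?F" for x y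
    proof -
      have "?c x \<otimes>\<^bsub>?B\<^esub> inv\<^bsub>?B\<^esub> ?c y = \<one>\<^bsub>?B\<^esub>"
        using c_one[of "x \<otimes>\<^bsub>?F\<^esub> inv\<^bsub>?F\<^esub> y"] that c.hom_mult[of x "inv\<^bsub>?F\<^esub> y"] c.hom_inv[of y]
        by (metis F.inv_closed F.m_closed)
      then show ?thesis
        using B.inv_solve_right'[of "\<one>\<^bsub>?B\<^esub>" "?c x" "?c y"] c.hom_closed that by (metis B.l_one B.one_closed)
    qed
    from c_eq[OF rN]
    have "?c (?t \<otimes>\<^bsub>?F\<^esub> ?a \<otimes>\<^bsub>?F\<^esub> inv\<^bsub>?F\<^esub> ?t) = ?c (?a [^]\<^bsub>?F\<^esub> m)" by simp
    then have cr: "?c ?t \<otimes>\<^bsub>?B\<^esub> ?c ?a \<otimes>\<^bsub>?B\<^esub> inv\<^bsub>?B\<^esub> ?c ?t = ?c ?a [^]\<^bsub>?B\<^esub> m"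
      by (simp only: c.hom_mult c.hom_inv c.hom_nat_pow F.m_closed F.inv_closed free_gen_carrier)
    show ?thesis
    proof
      fix x assume "x \<in> kernel ?F ?H h"
      then have x: "x \<in> carrier ?F" "h x = \<one>" by (auto simp: kernel_def)
      have "?c x \<in> generate ?B {?c ?a, ?c ?t}"
        using c.generate_img[of "range free_gen"] x
        by (simp add: generate_free_group) (simp add: ran)
      from B.BS_normal_form[OF _ _ cr this]
      obtain p q :: nat and k :: int
        where nf: "?c ?t [^]\<^bsub>?B\<^esub> p \<otimes>\<^bsub>?B\<^esub> ?c x = ?c ?a [^]\<^bsub>?B\<^esub> k \<otimes>\<^bsub>?B\<^esub> ?c ?t [^]\<^bsub>?B\<^esub> q"
        using c.hom_closed by fastforce
      have "?c (?t [^]\<^bsub>?F\<^esub> p \<otimes>\<^bsub>?F\<^esub> x) = ?c (?a [^]\<^bsub>?F\<^esub> k \<otimes>\<^bsub>?F\<^esub> ?t [^]\<^bsub>?F\<^esub> q)"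
        using x nf by (simp only: c.hom_mult c.hom_nat_pow c.hom_int_pow F.nat_pow_closed
            F.int_pow_closed free_gen_carrier)
      \<comment> \<open>Equality of cosets means that in the free group the normal form holds up to
        a factor \<open>z\<close> from \<open>?N\<close>.\<close>
      then have "?t [^]\<^bsub>?F\<^esub> p \<otimes>\<^bsub>?F\<^esub> x \<in> ?c (?a [^]\<^bsub>?F\<^esub> k \<otimes>\<^bsub>?F\<^esub> ?t [^]\<^bsub>?F\<^esub> q)"
        using x F.rcos_self[OF _ N.subgroup_axioms, of "?t [^]\<^bsub>?F\<^esub> p \<otimes>\<^bsub>?F\<^esub> x"] by simp
      then obtain z where z: "z \<in> ?N"
        "?t [^]\<^bsub>?F\<^esub> p \<otimes>\<^bsub>?F\<^esub> x = z \<otimes>\<^bsub>?F\<^esub> (?a [^]\<^bsub>?F\<^esub> k \<otimes>\<^bsub>?F\<^esub> ?t [^]\<^bsub>?F\<^esub> q)"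
        by (auto simp: r_coset_def)
      have zF: "z \<in> carrier ?F" "h z = \<one>" using z NK by (auto simp: kernel_def)
      have "h (?t [^]\<^bsub>?F\<^esub> p \<otimes>\<^bsub>?F\<^esub> x) = h (z \<otimes>\<^bsub>?F\<^esub> (?a [^]\<^bsub>?F\<^esub> k \<otimes>\<^bsub>?F\<^esub> ?t [^]\<^bsub>?F\<^esub> q))"
        using z by simp
      \<comment> \<open>Both \<open>x\<close> and \<open>z\<close> are sent to the identity by
        \<open>h\<close>.\<close>
      then have "t [^] p = a [^] k \<otimes> t [^] q"
        using x zF a t by (simp add: h.hom_nat_pow h.hom_int_pow hg)
      then have "k = 0" "p = q" using faithful by blast+
      then have eq: "?t [^]\<^bsub>?F\<^esub> p \<otimes>\<^bsub>?F\<^esub> x = z \<otimes>\<^bsub>?F\<^esub> ?t [^]\<^bsub>?F\<^esub> p" using z zF by simp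
      \<comment> \<open>With \<open>k = 0\<close> and \<open>p = q\<close>, the element
        \<open>x\<close> is the conjugate of \<open>z\<close> by a power of \<open>?t\<close>, hence
        lies in the normal subgroup \<open>?N\<close>.\<close>
      have "x = inv\<^bsub>?F\<^esub> (?t [^]\<^bsub>?F\<^esub> p) \<otimes>\<^bsub>?F\<^esub> (?t [^]\<^bsub>?F\<^esub> p \<otimes>\<^bsub>?F\<^esub> x)"
        using x by (simp flip: F.m_assoc)
      also have "\<dots> = inv\<^bsub>?F\<^esub> (?t [^]\<^bsub>?F\<^esub> p) \<otimes>\<^bsub>?F\<^esub> z \<otimes>\<^bsub>?F\<^esub> ?t [^]\<^bsub>?F\<^esub> p"
        unfolding eq using zF
        by (simp only: F.m_assoc F.inv_closed F.nat_pow_closed free_gen_carrier)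
      also have "\<dots> \<in> ?N" by (rule N.inv_op_closed1[OF _ z(1)]) simp
      finally show "x \<in> ?N" .
    qed
  qed
  with NK have "?N = kernel ?F ?H h" by blast
  moreover have "{u \<otimes>\<^bsub>?F\<^esub> inv\<^bsub>?F\<^esub> v |u v. (u, v) \<in> {(x, y)}} = {x \<otimes>\<^bsub>?F\<^esub> inv\<^bsub>?F\<^esub> y}" for x y
    by blast
  then have "BS1 m = ?F Mod ?N"
    unfolding BS1_def presented_group_def Let_def by (simp only:)
  ultimately have BS1: "BS1 m = ?F Mod kernel ?F ?H h" by (simp only:)
  show ?thesis
    unfolding BS1 by (rule h'.FactGroup_iso) (simp add: img)
qed

end


section \<open>Affine transformations of \<open>n\<close>-adic integers\<close>

text \<open>A word over \<open>{..<n}\<close> is read as the expansion of an integer in base \<open>n\<close>, least significant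
  digit first, so that words of length \<open>l\<close> represent the residues modulo \<open>n\<^sup>l\<close>.\<close>

abbreviation word_val :: "nat \<Rightarrow> nat list \<Rightarrow> int"
  where "word_val n \<equiv> horner_sum int (int n)"

text \<open>This is the affine map z -> c z + d of the \<open>n\<close>-adic integers, tested at
  each finite level: on words of length l it is a congruence modulo n^l.\<close>

definition affine_on_words :: "nat \<Rightarrow> int \<Rightarrow> int \<Rightarrow> (nat list \<Rightarrow> nat list) \<Rightarrow> bool"
  where "affine_on_words n c d f \<longleftrightarrow> (\<forall>w\<in>lists {..<n}. length (f w) = length w \<and>
    [word_val n (f w) = c * word_val n w + d] (mod (int n ^ length w)))"

text \<open>Digits in base \<open>n\<close> are unique: reduction modulo \<open>n\<close> determines
  the first digit, and after subtracting it and dividing by \<open>n\<close> the same argument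
  applies to the rest.\<close>

lemma word_val_inj:
  assumes "u \<in> lists {..<n}" "v \<in> lists {..<n}" "length u = length v"
    "[word_val n u = word_val n v] (mod (int n ^ length u))"
  shows "u = v"
  using assms(3,1,2,4)
proof (induction u v rule: list_induct2)
  case Nil
  show ?case by simp
next
  case (Cons x u y v)
  then have xy: "x < n" "y < n" by auto
  have c: "[int x + int n * word_val n u = int y + int n * word_val n v] (mod (int n * int n ^ length u))"
    using Cons.prems by simp
  then have "[int x + int n * word_val n u = int y + int n * word_val n v] (mod int n)"
    by (rule cong_modulus_mult)
  then have "x = y" using xy by (simp add: cong_def)
  with c have "int n * int n ^ length u dvd int n * (word_val n u - word_val n v)"
    by (simp add: cong_iff_dvd_diff algebra_simps)
  then have "[word_val n u = word_val n v] (mod (int n ^ length u))"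
    using xy by (simp add: cong_iff_dvd_diff)
  with \<open>x = y\<close> Cons show ?case by simp
qed

lemma word_val_replicate_0 [simp]: "word_val n (replicate l 0) = 0"
  by (induction l) auto

text \<open>A nonzero \<open>d\<close> cannot be divisible by n^|d|, which exceeds |d|. This turns
  congruences at all levels into equality of integers.\<close>

lemma eq_0_if_powers_dvd:
  fixes d :: int
  assumes "n > 1" "\<And>l. int n ^ l dvd d"
  shows "d = 0"
proof (rule ccontr)
  assume "d \<noteq> 0"
  with dvd_imp_le_int[OF _ assms(2)] have "int n ^ nat \<bar>d\<bar> \<le> \<bar>d\<bar>" by simp
  moreover have "nat \<bar>d\<bar> < n ^ nat \<bar>d\<bar>" using assms(1) by (simp add: power_gt_expt)
  then have "int (nat \<bar>d\<bar>) < int (n ^ nat \<bar>d\<bar>)" by (simp only: of_nat_less_iff)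
  ultimately show False by simp
qed

text \<open>The arguments 0 and 1, written as words of every length, recover first \<open>d\<close>
  and then \<open>c\<close>.\<close>

lemma affine_on_words_coeffs:
  assumes n: "n > 1" and f: "affine_on_words n c d f" "affine_on_words n c' d' f"
  shows "c = c'" "d = d'"
proof -
  have cong: "[c * word_val n w + d = c' * word_val n w + d'] (mod (int n ^ length w))"
    if "w \<in> lists {..<n}" for w
    using f that unfolding affine_on_words_def by (meson cong_sym cong_trans)
  have "int n ^ l dvd d - d'" for l
  proof -
    have "replicate l 0 \<in> lists {..<n}" using n by (auto simp: in_lists_conv_set)
    from cong[OF this] show ?thesis by (simp add: cong_iff_dvd_diff)
  qed
  then show d: "d = d'" using eq_0_if_powers_dvd[OF n, of "d - d'"] by simp
  have "int n ^ l dvd c - c'" for l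
  proof -
    \<comment> \<open>This word of length \<open>l + 1\<close> represents 1, so the modulus carries
      one factor \<open>n\<close> more than required.\<close>
    have "1 # replicate l 0 \<in> lists {..<n}" using n by (auto simp: in_lists_conv_set)
    from cong[OF this] have "int n * int n ^ l dvd c - c'" by (simp add: cong_iff_dvd_diff d)
    then show ?thesis by (rule dvd_mult_right)
  qed
  then show "c = c'" using eq_0_if_powers_dvd[OF n, of "c - c'"] by simp
qed

section \<open>Affine tree automorphisms under the group operations\<close>

lemma carrier_TreeAut: "carrier (TreeAut X) = tree_auts X"
  by (simp add: TreeAut_def)

lemma TreeAut_closed: "f \<in> tree_auts X \<Longrightarrow> w \<in> lists X \<Longrightarrow> f w \<in> lists X"
  unfolding tree_auts_def using Bij_imp_funcset by blast

lemma TreeAut_mult: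
  assumes "f \<in> tree_auts X" "g \<in> tree_auts X" "w \<in> lists X"
  shows "(f \<otimes>\<^bsub>TreeAut X\<^esub> g) w = f (g w)"
  using assms by (simp add: TreeAut_def BijGroup_def tree_auts_def compose_def)

lemma TreeAut_ext:
  assumes "f \<in> tree_auts X" "g \<in> tree_auts X" "\<And>w. w \<in> lists X \<Longrightarrow> f w = g w"
  shows "f = g"
  using assms(3)
  by (rule extensionalityI[rotated 2]) (use assms(1,2) in \<open>auto simp: tree_auts_def Bij_def\<close>)

context
  fixes n :: nat
begin

interpretation T: group "TreeAut {..<n}" by (rule group_TreeAut)

text \<open>The coefficients determine the value of each image word modulo n^l, with l its length,
  and hence its digits. Identities between automorphisms can thus be checked on
  coefficients.\<close>

lemma affine_on_words_unique:
  assumes "f \<in> tree_auts {..<n}" "g \<in> tree_auts {..<n}"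
    "affine_on_words n c d f" "affine_on_words n c d g"
  shows "f = g"
proof (rule TreeAut_ext[OF assms(1,2)])
  fix w assume w: "w \<in> lists {..<n}"
  then have "length (f w) = length w" "length (g w) = length w"
    "[word_val n (f w) = c * word_val n w + d] (mod (int n ^ length w))"
    "[word_val n (g w) = c * word_val n w + d] (mod (int n ^ length w))"
    using assms(3,4) unfolding affine_on_words_def by blast+
  then show "f w = g w"
    using TreeAut_closed[OF assms(1) w] TreeAut_closed[OF assms(2) w]
    by (intro word_val_inj) (simp_all, metis cong_sym cong_trans)
qed

lemma affine_on_words_one: "affine_on_words n 1 0 \<one>\<^bsub>TreeAut {..<n}\<^esub>"
  by (auto simp: affine_on_words_def TreeAut_def BijGroup_def)

lemma affine_on_words_mult:
  assumes "f \<in> tree_auts {..<n}" "g \<in> tree_auts {..<n}"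
    "affine_on_words n c d f" "affine_on_words n c' d' g"
  shows "affine_on_words n (c * c') (c * d' + d) (f \<otimes>\<^bsub>TreeAut {..<n}\<^esub> g)"
  unfolding affine_on_words_def
proof (intro ballI conjI)
  fix w assume w: "w \<in> lists {..<n}"
  let ?M = "int n ^ length w"
  have gw: "g w \<in> lists {..<n}" using TreeAut_closed assms(2) w by blast
  have len: "length (g w) = length w" "length (f (g w)) = length (g w)"
    using w gw assms by (auto simp: affine_on_words_def)
  have "[word_val n (f (g w)) = c * word_val n (g w) + d] (mod ?M)"
    using assms(3) gw len unfolding affine_on_words_def by metis
  moreover have "[word_val n (g w) = c' * word_val n w + d'] (mod ?M)"
    using assms(4) w unfolding affine_on_words_def by blast
  then have "[c * word_val n (g w) + d = c * (c' * word_val n w + d') + d] (mod ?M)"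
    by (intro cong_add cong_mult) auto
  ultimately show "[word_val n ((f \<otimes>\<^bsub>TreeAut {..<n}\<^esub> g) w)
      = c * c' * word_val n w + (c * d' + d)] (mod ?M)"
    using TreeAut_mult[OF assms(1,2) w] cong_trans by (fastforce simp: algebra_simps)
  show "length ((f \<otimes>\<^bsub>TreeAut {..<n}\<^esub> g) w) = length w"
    using TreeAut_mult[OF assms(1,2) w] len by simp
qed

text \<open>The inverse of \<open>g\<close> divides by \<open>c\<close>, so it need not have integer
  coefficients; in the quotient of two maps with the same \<open>c\<close> this division disappears
  and a translation is left.\<close>

lemma affine_on_words_div:
  assumes "f \<in> tree_auts {..<n}" "g \<in> tree_auts {..<n}"
    "affine_on_words n c d f" "affine_on_words n c e g"
  shows "affine_on_words n 1 (d - e) (f \<otimes>\<^bsub>TreeAut {..<n}\<^esub> inv\<^bsub>TreeAut {..<n}\<^esub> g)"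
  unfolding affine_on_words_def
proof (intro ballI)
  fix w assume w: "w \<in> lists {..<n}"
  \<comment> \<open>With \<open>u\<close> the preimage of \<open>w\<close> under \<open>g\<close>,
    subtracting the congruences for \<open>f u\<close> and \<open>g u = w\<close> eliminates
    \<open>u\<close>.\<close>
  define u where "u = (inv\<^bsub>TreeAut {..<n}\<^esub> g) w"
  have g': "inv\<^bsub>TreeAut {..<n}\<^esub> g \<in> tree_auts {..<n}"
    using assms(2) T.inv_closed carrier_TreeAut by blast
  have u: "u \<in> lists {..<n}" using TreeAut_closed[OF g' w] by (simp add: u_def)
  have "g u = (g \<otimes>\<^bsub>TreeAut {..<n}\<^esub> inv\<^bsub>TreeAut {..<n}\<^esub> g) w"
    using TreeAut_mult[OF assms(2) g' w] by (simp add: u_def)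
  also have "\<dots> = \<one>\<^bsub>TreeAut {..<n}\<^esub> w"
    using assms(2) T.r_inv carrier_TreeAut by metis
  also have "\<dots> = w" using w by (simp add: TreeAut_def BijGroup_def)
  finally have gu: "g u = w" .
  have len: "length u = length w" "length (f u) = length w"
    using assms(3,4) u gu unfolding affine_on_words_def by metis+
  have "[word_val n (f u) = c * word_val n u + d] (mod (int n ^ length w))"
    "[word_val n w = c * word_val n u + e] (mod (int n ^ length w))"
    using assms(3,4) u gu len unfolding affine_on_words_def by metis+
  from cong_diff[OF this]
  have "[word_val n (f u) = 1 * word_val n w + (d - e)] (mod (int n ^ length w))"
    by (simp add: cong_iff_dvd_diff algebra_simps)
  then show "length ((f \<otimes>\<^bsub>TreeAut {..<n}\<^esub> inv\<^bsub>TreeAut {..<n}\<^esub> g) w) = length w \<and>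
     [word_val n ((f \<otimes>\<^bsub>TreeAut {..<n}\<^esub> inv\<^bsub>TreeAut {..<n}\<^esub> g) w)
      = 1 * word_val n w + (d - e)] (mod (int n ^ length w))"
    using TreeAut_mult[OF assms(1) g' w] len by (simp add: u_def)
qed

lemma affine_on_words_pow_linear:
  assumes "f \<in> tree_auts {..<n}" "affine_on_words n c 0 f"
  shows "affine_on_words n (c ^ p) 0 (f [^]\<^bsub>TreeAut {..<n}\<^esub> (p::nat))"
proof (induction p)
  case 0
  show ?case by (simp add: affine_on_words_one)
next
  case (Suc p)
  have "f [^]\<^bsub>TreeAut {..<n}\<^esub> p \<in> tree_auts {..<n}"
    using assms(1) T.nat_pow_closed carrier_TreeAut by blast
  from affine_on_words_mult[OF this assms(1) Suc assms(2)]
  show ?case by (simp add: mult.commute)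
qed

lemma affine_on_words_pow_translation:
  assumes "f \<in> tree_auts {..<n}" "affine_on_words n 1 1 f"
  shows "affine_on_words n 1 k (f [^]\<^bsub>TreeAut {..<n}\<^esub> (k::int))"
proof -
  have pow: "f [^]\<^bsub>TreeAut {..<n}\<^esub> i \<in> tree_auts {..<n}" for i :: int
    using assms(1) T.int_pow_closed carrier_TreeAut by blast
  have f: "f \<in> carrier (TreeAut {..<n})" using assms(1) by (simp add: carrier_TreeAut)
  show ?thesis
  \<comment> \<open>The induction runs from 0 in both directions; the downward step divides by
    \<open>f\<close> by means of \<open>affine_on_words_div\<close>.\<close>
  proof (induction k rule: int_induct[where k = 0])
    case base
    show ?case by (simp add: affine_on_words_one)
  next
    case (step1 i)
    from affine_on_words_mult[OF pow assms(1) step1(2) assms(2)]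
    show ?case using f by (simp add: T.int_pow_mult add.commute[of 1 i])
  next
    case (step2 i)
    from affine_on_words_div[OF pow assms(1) step2(2) assms(2)]
    show ?case using f by (simp add: T.int_pow_diff)
  qed
qed

end


section \<open>The automaton \<open>S\<^bsub>m,n\<^esub>\<close>\<close>

text \<open>The automaton performs digitwise multiplication with carry: m (x + n z) + i = (m x + i)
  + n m z. The remainder of m x + i modulo \<open>n\<close> is the output digit, and the quotient is
  the carry, which becomes the next state.\<close>

lemma affine_on_words_state_aut:
  "affine_on_words n (int m) (int i) (state_aut (S_automaton m n) i)"
proof -
  have "[word_val n (act (S_automaton m n) i w) = int m * word_val n w + int i]
      (mod (int n ^ length w))" for w
  proof (induction w arbitrary: i)
    case Nil
    show ?case by simp
  next
    case (Cons x w)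
    let ?s = "m * x + i"
    \<comment> \<open>Multiplying the induction hypothesis by \<open>n\<close>, together with its
      modulus, makes room for the first digit.\<close>
    have "[int n * word_val n (act (S_automaton m n) (?s div n) w)
        = int n * (int m * word_val n w + int (?s div n))] (mod (int n * int n ^ length w))"
      using Cons[of "?s div n"]
      by (simp add: cong_iff_dvd_diff flip: right_diff_distrib)
    then have "[int (?s mod n) + int n * word_val n (act (S_automaton m n) (?s div n) w)
        = int (?s mod n) + int n * (int m * word_val n w + int (?s div n))] (mod (int n * int n ^ length w))"
      by (intro cong_add) auto
    moreover have "int (?s mod n) + int n * int (?s div n) = int ?s"
      by (metis mod_mult_div_eq of_nat_add of_nat_mult)
    then have "int (?s mod n) + int n * (int m * word_val n w + int (?s div n))
        = int m * word_val n (x # w) + int i"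
      by (simp add: algebra_simps)
    ultimately show ?case by (simp add: S_automaton_def)
  qed
  then show ?thesis
    by (auto simp: affine_on_words_def state_aut_def S_automaton_def)
qed

theorem proposition3:
  fixes m n :: nat
  assumes "m > 1" and "n > 1" and "coprime m n"
  shows "automaton_group (S_automaton m n) \<cong> BS1 m"
proof -
  let ?A = "S_automaton m n" and ?T = "TreeAut {..<n}"
  interpret A: invertible_automaton ?A using assms by (intro S_automaton_invertible) auto
  interpret T: group ?T by (rule group_TreeAut)
  have [simp]: "states ?A = {..<m}" "alphabet ?A = {..<n}" by (simp_all add: S_automaton_def)
  define s where "s = state_aut ?A"
  define t where "t = s 0"
  define a where "a = s 1 \<otimes>\<^bsub>?T\<^esub> inv\<^bsub>?T\<^esub> s 0"
  have s: "s i \<in> carrier ?T" if "i < m" for i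
    using A.state_aut_tree_auts[of i] that by (simp add: s_def carrier_TreeAut)
  have s_aff: "affine_on_words n (int m) (int i) (s i)" for i
    unfolding s_def by (rule affine_on_words_state_aut)
  have t: "t \<in> carrier ?T" and a: "a \<in> carrier ?T"
    using assms s by (auto simp: t_def a_def)
  have t_aff: "affine_on_words n (int m) 0 t"
    using s_aff[of 0] by (simp add: t_def)
  have a_aff: "affine_on_words n 1 1 a"
    using affine_on_words_div[of "s 1" n "s 0", OF _ _ s_aff s_aff] s assms
    by (simp add: a_def carrier_TreeAut)
  \<comment> \<open>The normal forms act as z -> m^q z + k. This yields the formula for each
    \<open>s i\<close>, the defining relation and the faithfulness.\<close>
  have at_aff: "affine_on_words n (int m ^ q) k (a [^]\<^bsub>?T\<^esub> k \<otimes>\<^bsub>?T\<^esub> t [^]\<^bsub>?T\<^esub> q)"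
    for k :: int and q :: nat
    using affine_on_words_mult[OF _ _ affine_on_words_pow_translation[OF _ a_aff]
        affine_on_words_pow_linear[OF _ t_aff], of k q] a t
    by (simp flip: carrier_TreeAut)
  have s_eq: "s i = a [^]\<^bsub>?T\<^esub> int i \<otimes>\<^bsub>?T\<^esub> t" if "i < m" for i
    using affine_on_words_unique[OF _ _ s_aff at_aff[of 1 "int i", simplified]] s a t that
    by (simp flip: carrier_TreeAut)
  \<comment> \<open>Both sides act as z -> m z + m.\<close>
  have "t \<otimes>\<^bsub>?T\<^esub> a = a [^]\<^bsub>?T\<^esub> int m \<otimes>\<^bsub>?T\<^esub> t"
    using affine_on_words_unique[OF _ _ affine_on_words_mult[OF _ _ t_aff a_aff],
        of "a [^]\<^bsub>?T\<^esub> int m \<otimes>\<^bsub>?T\<^esub> t"] at_aff[of 1 "int m"] a t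
    by (simp flip: carrier_TreeAut)
  then have rel: "t \<otimes>\<^bsub>?T\<^esub> a \<otimes>\<^bsub>?T\<^esub> inv\<^bsub>?T\<^esub> t = a [^]\<^bsub>?T\<^esub> m"
    using a t by (simp add: int_pow_int T.m_assoc)
  have gen: "generate ?T (s ` {..<m}) = generate ?T {a, t}"
  proof
    have sub: "subgroup (generate ?T {a, t}) ?T"
      using a t by (intro T.generate_is_subgroup) auto
    have "s i \<in> generate ?T {a, t}" if "i < m" for i
      unfolding s_eq[OF that]
      by (intro subgroup.m_closed[OF sub] T.subgroup_int_pow_closed[OF sub] generate.incl) auto
    then show "generate ?T (s ` {..<m}) \<subseteq> generate ?T {a, t}"
      by (intro T.generate_subgroup_incl sub image_subsetI) auto
    have sub': "subgroup (generate ?T (s ` {..<m})) ?T"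
      using s by (intro T.generate_is_subgroup) auto
    have "s 0 \<in> generate ?T (s ` {..<m})" "s 1 \<in> generate ?T (s ` {..<m})"
      using assms by (auto intro!: generate.incl)
    then have "{a, t} \<subseteq> generate ?T (s ` {..<m})"
      using sub' by (auto simp: a_def t_def intro!: subgroup.m_closed subgroup.m_inv_closed)
    then show "generate ?T {a, t} \<subseteq> generate ?T (s ` {..<m})"
      by (rule T.generate_subgroup_incl[OF _ sub'])
  qed
  have "BS1 m \<cong> ?T\<lparr>carrier := generate ?T {a, t}\<rparr>"
  proof (rule T.BS1_iso[OF a t rel])
    fix p q :: nat and k :: int
    assume eq: "t [^]\<^bsub>?T\<^esub> p = a [^]\<^bsub>?T\<^esub> k \<otimes>\<^bsub>?T\<^esub> t [^]\<^bsub>?T\<^esub> q"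
    have "affine_on_words n (int m ^ p) 0 (t [^]\<^bsub>?T\<^esub> p)"
      using affine_on_words_pow_linear[OF _ t_aff] t by (simp add: carrier_TreeAut)
    moreover have "affine_on_words n (int m ^ q) k (t [^]\<^bsub>?T\<^esub> p)"
      using at_aff by (simp add: eq)
    \<comment> \<open>The same automorphism is described by two pairs of coefficients, which must
      agree; as \<open>m > 1\<close>, equal powers of \<open>m\<close> have equal exponents.\<close>
    ultimately have "int m ^ p = int m ^ q" "k = 0"
      using affine_on_words_coeffs[OF assms(2)] by blast+
    then show "k = 0 \<and> p = q" using assms(1) by simp
  qed
  then have "BS1 m \<cong> automaton_group ?A"
    by (simp add: automaton_group_def gen[unfolded s_def])
  then show ?thesis by (rule group.iso_sym[OF group_BS1])
qed

end
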